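(* For each separable metric space $X$, $\dim_G(X)\le\omega_1$.
   Context: For an ordinal $\alpha$, the game ${\sf G}_c^{\alpha}(\mathcal{O},\mathcal{O})$ on a separable metric space $X$ has one inning per $\gamma<\alpha$: in inning $\gamma$ player ONE chooses an open cover $A_\gamma$ of $X$ and TWO responds with a pairwise disjoint family $B_\gamma$ of sets refining $A_\gamma$ (each member of $B_\gamma$ is contained in a member of $A_\gamma$). TWO wins the play if $\bigcup_{\gamma<\alpha}B_\gamma$ is an open cover of $X$; otherwise ONE wins. ${\sf tp}_{{\sf S}_c(\mathcal{O},\mathcal{O})}(X)$ is the least ordinal $\alpha$ such that TWO has a winning strategy in this game on $X$. The game dimension $\dim_G(X)$ is defined by $1+\dim_G(X)={\sf tp}_{{\sf S}_c(\mathcal{O},\mathcal{O})}(X)$ (so $\dim_G(\emptyset)=-1$). $\omega_1$ is the first uncountable ordinal. *)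

theory Defs
  imports "HOL-Analysis.Analysis" "HOL-Library.Option_ord"
begin

section \<open>Ordinals\<close>

text \<open>
  Ordinals are order types of well-orders whose field is a set of subsets of the natural
  numbers, that is, all ordinals below the cardinal successor of the continuum.  This is enough
  for games on separable metric spaces: such a space has at most continuum many points, and TWO
  wins any game that has one inning per point, by playing in each inning one member of ONE's cover
  that contains the point. So the least length defined below is attained within this type.
\<close>

quotient_type ordinal = "nat set rel" / partial: "\<lambda>r s. (r, s) \<in> ordIso"
proof (rule part_equivpI)
  have "({} :: nat set rel, {} :: nat set rel) \<in> ordIso"
    by (rule ordIso_reflexive) simp
  then show "\<exists>r :: nat set rel. (r, r) \<in> ordIso" by blast
  show "symp (\<lambda>r s :: nat set rel. (r, s) \<in> ordIso)"
    by (auto intro: sympI ordIso_symmetric)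
  show "transp (\<lambda>r s :: nat set rel. (r, s) \<in> ordIso)"
    by (auto intro: transpI ordIso_transitive)
qed

instantiation ordinal :: wellorder
begin

lift_definition less_eq_ordinal :: "ordinal \<Rightarrow> ordinal \<Rightarrow> bool" is "\<lambda>r s. (r, s) \<in> ordLeq"
  by (meson ordIso_ordLeq_trans ordLeq_ordIso_trans ordIso_symmetric)

lift_definition less_ordinal :: "ordinal \<Rightarrow> ordinal \<Rightarrow> bool" is "\<lambda>r s. (r, s) \<in> ordLess"
  by (meson ordIso_ordLess_trans ordLess_ordIso_trans ordIso_symmetric)

instance
proof
  have wo: "Well_order r" if "(r, r) \<in> ordIso" for r :: "nat set rel"
    using that by (auto simp: ordIso_def)
  fix a b c :: ordinal
  show "a < b \<longleftrightarrow> a \<le> b \<and> \<not> b \<le> a"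
    by transfer (metis wo not_ordLeq_iff_ordLess ordLess_imp_ordLeq)
  show "a \<le> a"
    by transfer (rule ordIso_imp_ordLeq)
  show "a \<le> b \<Longrightarrow> b \<le> c \<Longrightarrow> a \<le> c"
    by transfer (rule ordLeq_transitive)
  show "a \<le> b \<Longrightarrow> b \<le> a \<Longrightarrow> a = b"
    by transfer (simp add: ordIso_iff_ordLeq)
  show "a \<le> b \<or> b \<le> a"
    by transfer (rule ordLeq_total[OF wo wo])
next
  fix P :: "ordinal \<Rightarrow> bool" and a :: ordinal
  assume step: "\<And>x. (\<And>y. y < x \<Longrightarrow> P y) \<Longrightarrow> P x"
  have abs_rep: "(rep_ordinal y, rep_ordinal y) \<in> ordIso" "y = abs_ordinal (rep_ordinal y)"
    for y :: ordinal
    using Quotient3_rep_reflp[OF Quotient3_ordinal, of y]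
      Quotient3_abs_rep[OF Quotient3_ordinal, of y] by simp_all
  have "(r, r) \<in> ordIso \<longrightarrow> P (abs_ordinal r)" for r :: "nat set rel"
  proof (induction r rule: wf_induct_rule[OF wf_ordLess])
    case (1 r)
    show ?case
    proof
      assume r: "(r, r) \<in> ordIso"
      show "P (abs_ordinal r)"
      proof (rule step)
        fix y assume y: "y < abs_ordinal r"
        obtain s where s: "(s, s) \<in> ordIso" "y = abs_ordinal s"
          using abs_rep by metis
        with y r have "(s, r) \<in> ordLess" by (simp add: less_ordinal.abs_eq)
        with 1 s show "P y" by blast
      qed
    qed
  qed
  then show "P a"
    using abs_rep by metis
qed

end

text \<open>
  Ordinal addition: \<open>\<alpha> + \<beta>\<close> is the least ordinal that is at least \<open>\<alpha>\<close> and exceeds \<open>\<alpha> + \<gamma>\<close>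
  for every \<open>\<gamma> < \<beta>\<close>.
\<close>

function ord_plus :: "ordinal \<Rightarrow> ordinal \<Rightarrow> ordinal" where
  "ord_plus \<alpha> \<beta> = (LEAST \<delta>. \<alpha> \<le> \<delta> \<and> (\<forall>\<epsilon> \<in> ord_plus \<alpha> ` {..<\<beta>}. \<epsilon> < \<delta>))"
  by auto
termination
  by (relation "inv_image {(x, y). x < y} snd") (auto intro: wf_inv_image wf)

declare ord_plus.simps [simp del]

instantiation ordinal :: "{zero, one, plus}"
begin

definition zero_ordinal :: ordinal where
  "0 = (LEAST \<alpha> :: ordinal. True)"

definition one_ordinal :: ordinal where
  "1 = (LEAST \<alpha> :: ordinal. 0 < \<alpha>)"

definition plus_ordinal :: "ordinal \<Rightarrow> ordinal \<Rightarrow> ordinal" where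
  "\<alpha> + \<beta> = ord_plus \<alpha> \<beta>"

instance ..

end

definition omega1 :: ordinal where
  "omega1 = (LEAST \<alpha>. uncountable {..<\<alpha>})"


section \<open>The selective screenability game\<close>

definition open_cover :: "'a topology \<Rightarrow> 'a set set \<Rightarrow> bool" where
  "open_cover X A \<longleftrightarrow> (\<forall>U\<in>A. openin X U) \<and> \<Union>A = topspace X"

text \<open>
  The members of a response need not be open; openness enters only through the winning condition.
\<close>

definition legal_response :: "'a set set \<Rightarrow> 'a set set \<Rightarrow> bool" where
  "legal_response A B \<longleftrightarrow> pairwise disjnt B \<and> (\<forall>V\<in>B. \<exists>U\<in>A. V \<subseteq> U)"

text \<open>
  A strategy for TWO maps an inning \<open>\<gamma>\<close> and the sequence of ONE's moves in the innings up to and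
  including \<open>\<gamma>\<close> to TWO's response. TWO's own earlier moves are determined by these data.
\<close>

type_synonym 'a strategy = "ordinal \<Rightarrow> (ordinal \<Rightarrow> 'a set set) \<Rightarrow> 'a set set"

definition response :: "'a strategy \<Rightarrow> (ordinal \<Rightarrow> 'a set set) \<Rightarrow> ordinal \<Rightarrow> 'a set set" where
  "response \<sigma> A \<gamma> = \<sigma> \<gamma> (restrict A {..\<gamma>})"

definition winning_strategy_TWO :: "ordinal \<Rightarrow> 'a topology \<Rightarrow> 'a strategy \<Rightarrow> bool" where
  "winning_strategy_TWO \<alpha> X \<sigma> \<longleftrightarrow>
     (\<forall>A. (\<forall>\<gamma><\<alpha>. open_cover X (A \<gamma>)) \<longrightarrow>
          (\<forall>\<gamma><\<alpha>. legal_response (A \<gamma>) (response \<sigma> A \<gamma>)) \<and>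
          open_cover X (\<Union>\<gamma>\<in>{..<\<alpha>}. response \<sigma> A \<gamma>))"

definition tp_Sc :: "'a topology \<Rightarrow> ordinal" where
  "tp_Sc X = (LEAST \<alpha>. \<exists>\<sigma>. winning_strategy_TWO \<alpha> X \<sigma>)"


section \<open>Game dimension\<close>

text \<open>
  Dimensions range over the ordinals together with \<open>-1\<close>. They are represented by
  \<^typ>\<open>ordinal option\<close>, where \<^const>\<open>None\<close> stands for \<open>-1\<close> and is the least element. Every
  ordinal is \<open>1 + d\<close> for exactly one such \<open>d\<close>, with \<open>1 + (-1) = 0\<close>.
\<close>

fun one_plus :: "ordinal option \<Rightarrow> ordinal" where
  "one_plus None = 0"
| "one_plus (Some \<beta>) = 1 + \<beta>"

definition game_dim :: "'a topology \<Rightarrow> ordinal option" where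
  "game_dim X = (THE d. one_plus d = tp_Sc X)"

end

theory Submission
  imports Defs
begin

text \<open>
  TWO's strategy looks only at ONE's current cover. Let \<open>C\<close> be a countable dense set. The sets
  \<open>D \<gamma> = g \<gamma> + \<rat>\<close>, for an injection \<open>g\<close> of the countable ordinals into the reals, are
  countable and dense, and every real number lies in only countably many of them. Hence every point
  \<open>x\<close> has some \<open>\<gamma> < \<omega>\<^sub>1\<close> for which no distance \<open>d c x\<close> with \<open>c \<in> C\<close> lies in \<open>D \<gamma>\<close>. The points
  with this property for a fixed \<open>\<gamma>\<close> lie on no sphere with center in \<open>C\<close> and radius in \<open>D \<gamma>\<close>,
  so TWO covers all of them in inning \<open>\<gamma>\<close>: list the balls with such centers and radii that fit
  into ONE's cover and remove from each of them the closed balls that come earlier.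
\<close>

section \<open>Ordinals\<close>

lemma ordinal_cases:
  fixes \<alpha> :: ordinal
  obtains r where "Well_order r" "\<alpha> = abs_ordinal r"
proof -
  have "(rep_ordinal \<alpha>, rep_ordinal \<alpha>) \<in> ordIso" "\<alpha> = abs_ordinal (rep_ordinal \<alpha>)"
    using Quotient3_rep_reflp[OF Quotient3_ordinal, of \<alpha>]
      Quotient3_abs_rep[OF Quotient3_ordinal, of \<alpha>] by simp_all
  then show thesis
    using that by (auto simp: ordIso_def)
qed

lemma abs_ordinal_less:
  assumes "(r, s) \<in> ordLess"
  shows "abs_ordinal r < abs_ordinal s"
proof -
  have "(r, r) \<in> ordIso" "(s, s) \<in> ordIso"
    using assms by (auto simp: ordLess_def intro: ordIso_reflexive)
  with assms show ?thesis
    by (simp add: less_ordinal.abs_eq)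
qed

text \<open>The old order is the initial segment of \<open>s\<close> strictly below the new top
  \<open>z\<close>, hence of smaller order type. This supplies larger ordinals.\<close>

lemma Well_order_add_top:
  assumes r: "Well_order r" and z: "z \<notin> Field r"
  defines "s \<equiv> r \<union> insert z (Field r) \<times> {z}"
  shows "Well_order s" "(r, s) \<in> ordLess"
proof -
  have F: "Field s = insert z (Field r)"
    by (auto simp: s_def Field_def)
  have lin: "Refl r" "trans r" "antisym r" "Total r" and wf: "wf (r - Id)"
    using r by (auto simp: order_on_defs)
  have fld: "a \<in> Field r" "b \<in> Field r" if "(a, b) \<in> r" for a b
    using that by (auto simp: Field_def)
  have "refl_on (Field s) s"
    unfolding F using lin(1) by (auto simp: s_def refl_on_def)
  moreover have "trans s"
    using lin(2) fld z unfolding trans_def s_def by blast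
  moreover have "antisym s"
    using lin(3) fld z unfolding antisym_def s_def by blast
  moreover have "Total s"
    unfolding F using lin(4) by (auto simp: s_def total_on_def)
  moreover have "wf (s - Id)"
  proof (rule wf_subset)
    \<comment> \<open>No new pair can be followed by a pair of \<open>r\<close>, since
      \<open>z\<close> lies outside \<open>Field r\<close>. This compatibility makes the union of
      the two relations well-founded.\<close>
    have "wf (Field r \<times> {z})"
      using z by (intro wfI[of _ "Field r" "{z}"]) auto
    then show "wf ((r - Id) \<union> Field r \<times> {z})"
      using wf_union_compatible[of "Field r \<times> {z}" "r - Id"] wf z fld
      by (auto simp: Un_commute)
    show "s - Id \<subseteq> (r - Id) \<union> Field r \<times> {z}"
      by (auto simp: s_def)
  qed
  moreover have "s \<subseteq> Field s \<times> Field s"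
    by (auto simp: Field_def)
  ultimately show s: "Well_order s"
    by (auto simp: order_on_defs)
  have "Restr s (underS s z) = r"
    using z fld by (auto simp: s_def underS_def)
  with underS_Restr_ordLess[OF s, of z] F show "(r, s) \<in> ordLess"
    by auto
qed

text \<open>Ensures that the \<open>LEAST\<close> in the definitions of \<open>1\<close> and of
  \<open>1 + \<beta>\<close> ranges over a nonempty set.\<close>

lemma ordinal_no_top: "\<exists>\<beta> :: ordinal. \<alpha> < \<beta>"
proof -
  obtain r :: "nat set rel" where r: "Well_order r" "\<alpha> = abs_ordinal r"
    by (rule ordinal_cases)
  \<comment> \<open>The field of \<open>r\<close> may be everything, so room for a new top element is made first.\<close>
  define r' where "r' = dir_image r (image Suc)"
  have inj: "inj_on (image Suc) (Field r)"
    by (simp add: inj_on_def inj_image_eq_iff)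
  have r': "Well_order r'" "(r, r') \<in> ordIso"
    unfolding r'_def using r(1) inj by (rule Well_order_dir_image dir_image_ordIso)+
  have "{0} \<notin> Field r'"
    by (auto simp: r'_def dir_image_Field)
  from Well_order_add_top(2)[OF r'(1) this] r'(2) r(2) show ?thesis
    by (metis abs_ordinal_less ordIso_ordLess_trans)
qed

text \<open>The proper initial segments of a well-order on all sets of naturals have pairwise
  distinct types, so the type of that order has uncountably many predecessors and the
  \<open>LEAST\<close> is attained.\<close>

lemma uncountable_lessThan_omega1: "uncountable {..<omega1}"
proof -
  define r where "r = card_of (UNIV :: nat set set)"
  define f where "f a = abs_ordinal (Restr r (underS r a))" for a
  have r: "Well_order r" "Field r = UNIV"
    unfolding r_def by (rule card_of_Well_order Field_card_of)+
  have wo: "wo_rel r"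
    using r by (simp add: wo_rel_def)
  have less: "f a < f b" if "(a, b) \<in> r" "a \<noteq> b" for a b
  proof -
    let ?s = "Restr r (underS r b)"
    have a: "a \<in> underS r b"
      using that by (simp add: underS_def)
    have "underS r a \<subseteq> underS r b"
      using that wo_rel.ANTISYM[OF wo] wo_rel.TRANS[OF wo]
      by (auto simp: underS_def antisym_def dest: transD)
    then have "Restr ?s (underS ?s a) = Restr r (underS r a)"
      using a by (auto simp: underS_def)
    moreover have "Field ?s \<noteq> {}"
      using a wo_rel.REFL[OF wo] r(2) by (auto simp: Field_def refl_on_def)
    ultimately show ?thesis
      unfolding f_def
      using underS_Restr_ordLess[OF Well_order_Restr[OF r(1), of "underS r b"], of a]
      by (metis abs_ordinal_less)
  qed
  have "inj f"
  proof (rule injI, rule ccontr)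
    fix a b assume "f a = f b" "a \<noteq> b"
    then show False
      using less wo_rel.TOTAL[OF wo] r(2) unfolding total_on_def by (metis UNIV_I less_irrefl)
  qed
  moreover have "uncountable (UNIV :: nat set set)"
    using nat_sets_eqpoll_reals countable_eqpoll eqpoll_sym uncountable_UNIV_real by blast
  ultimately have "uncountable (range f)"
    using countable_image_inj_on by blast
  moreover have "range f \<subseteq> {..<abs_ordinal r}"
    using underS_Restr_ordLess[OF r(1)] r(2) by (auto simp: f_def intro: abs_ordinal_less)
  ultimately have "uncountable {..<abs_ordinal r}"
    using countable_subset by blast
  then show ?thesis
    unfolding omega1_def by (rule LeastI)
qed

section \<open>Countable ordinals and their coding by reals\<close>

lemma countable_lessThan_if_less_omega1: "\<gamma> < omega1 \<Longrightarrow> countable {..<\<gamma>}"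
  unfolding omega1_def using not_less_Least by blast

text \<open>At a least \<open>\<beta>\<close> with \<open>f \<beta> < \<beta>\<close>, monotonicity
  makes \<open>f \<beta>\<close> a smaller counterexample.\<close>

lemma strict_mono_on_lessThan_ge:
  fixes f :: "'a::wellorder \<Rightarrow> 'a"
  assumes "strict_mono_on {..<\<alpha>} f" "\<beta> < \<alpha>"
  shows "\<beta> \<le> f \<beta>"
  using \<open>\<beta> < \<alpha>\<close>
proof (induction \<beta> rule: less_induct)
  case (less \<beta>)
  show ?case
  proof (rule ccontr)
    assume "\<not> \<beta> \<le> f \<beta>"
    then have *: "f \<beta> < \<beta>" by simp
    then have "f (f \<beta>) < f \<beta>"
      using assms(1) less.prems by (auto simp: strict_mono_on_def)
    with less.IH[OF *] less.prems * show False
      by (meson leD less_trans)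
  qed
qed

text \<open>A countable initial segment is coded by the order that its enumeration induces on \<open>\<nat>\<close>.\<close>

lemma inj_on_real_if_countable_lessThan:
  fixes S :: "'a::wellorder set"
  assumes "\<And>\<alpha>. \<alpha> \<in> S \<Longrightarrow> countable {..<\<alpha>}"
  obtains g :: "'a \<Rightarrow> real" where "inj_on g S"
proof -
  define h where "h \<alpha> = to_nat_on {..<\<alpha>}" for \<alpha> :: 'a
  define R where "R \<alpha> = {(h \<alpha> \<beta>, h \<alpha> \<gamma>) | \<beta> \<gamma>. \<beta> \<le> \<gamma> \<and> \<gamma> < \<alpha>}" for \<alpha>
  have inj: "inj_on (h \<alpha>) {..<\<alpha>}" if "\<alpha> \<in> S" for \<alpha>
    using assms[OF that] by (simp add: h_def inj_on_to_nat_on)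
  have neq: "R \<alpha> \<noteq> R \<alpha>'" if S: "\<alpha> \<in> S" "\<alpha>' \<in> S" and "\<alpha> < \<alpha>'" for \<alpha> \<alpha>'
  proof
    assume eq: "R \<alpha> = R \<alpha>'"
    \<comment> \<open>If the codes agree, matching equal indices of the two enumerations embeds
      \<open>{..<\<alpha>'}\<close> strictly increasingly into \<open>{..<\<alpha>}\<close>, which
      would send \<open>\<alpha>\<close> below itself.\<close>
    define f where "f \<beta> = inv_into {..<\<alpha>} (h \<alpha>) (h \<alpha>' \<beta>)" for \<beta>
    have le: "f \<beta> \<le> f \<gamma>" "f \<gamma> < \<alpha>" "h \<alpha> (f \<beta>) = h \<alpha>' \<beta>" if "\<beta> \<le> \<gamma>" "\<gamma> < \<alpha>'" for \<beta> \<gamma>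
    proof -
      have "(h \<alpha>' \<beta>, h \<alpha>' \<gamma>) \<in> R \<alpha>"
        unfolding eq using that by (auto simp: R_def)
      then obtain \<beta>0 \<gamma>0 where *: "\<beta>0 \<le> \<gamma>0" "\<gamma>0 < \<alpha>" "h \<alpha>' \<beta> = h \<alpha> \<beta>0" "h \<alpha>' \<gamma> = h \<alpha> \<gamma>0"
        by (auto simp: R_def)
      then have "f \<beta> = \<beta>0" "f \<gamma> = \<gamma>0"
        unfolding f_def using inj[OF S(1)] by (auto intro!: inv_into_f_eq)
      with * show "f \<beta> \<le> f \<gamma>" "f \<gamma> < \<alpha>" "h \<alpha> (f \<beta>) = h \<alpha>' \<beta>" by simp_all
    qed
    have "strict_mono_on {..<\<alpha>'} f"
    proof (rule strict_mono_onI)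
      fix \<beta> \<gamma> assume *: "\<beta> \<in> {..<\<alpha>'}" "\<gamma> \<in> {..<\<alpha>'}" "\<beta> < \<gamma>"
      then have "h \<alpha>' \<beta> \<noteq> h \<alpha>' \<gamma>"
        using inj[OF S(2)] by (auto dest: inj_onD)
      then have "f \<beta> \<noteq> f \<gamma>"
        using le(3)[of \<beta> \<beta>] le(3)[of \<gamma> \<gamma>] * by auto
      with le(1)[of \<beta> \<gamma>] * show "f \<beta> < f \<gamma>"
        by (simp add: order_less_le)
    qed
    from strict_mono_on_lessThan_ge[OF this \<open>\<alpha> < \<alpha>'\<close>] le(2)[of \<alpha> \<alpha>] \<open>\<alpha> < \<alpha>'\<close>
    show False by auto
  qed
  obtain e :: "nat set \<Rightarrow> real" where e: "inj e"
    using nat_sets_eqpoll_reals by (auto simp: eqpoll_def bij_betw_def)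
  have "inj_on (\<lambda>\<alpha>. e (prod_encode ` R \<alpha>)) S"
  proof (rule inj_onI)
    fix \<alpha> \<alpha>' assume *: "\<alpha> \<in> S" "\<alpha>' \<in> S" "e (prod_encode ` R \<alpha>) = e (prod_encode ` R \<alpha>')"
    then have "R \<alpha> = R \<alpha>'"
      using e by (simp add: inj_eq inj_image_eq_iff inj_prod_encode)
    then show "\<alpha> = \<alpha>'"
      using neq * by (metis neqE)
  qed
  then show thesis by (rule that)
qed


section \<open>Game dimension\<close>

lemma zero_ordinal_le: "(0 :: ordinal) \<le> \<alpha>"
  by (simp add: zero_ordinal_def Least_le)

lemma zero_less_one_ordinal: "(0 :: ordinal) < 1"
  unfolding one_ordinal_def by (rule LeastI_ex) (rule ordinal_no_top)

lemma one_ordinal_le: "(0 :: ordinal) < \<alpha> \<Longrightarrow> 1 \<le> \<alpha>"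
  unfolding one_ordinal_def by (rule Least_le)

section \<open>Left addition of one\<close>

lemma one_plus_le:
  fixes \<beta> \<delta> :: ordinal
  assumes "1 \<le> \<delta>" "\<And>\<gamma>. \<gamma> < \<beta> \<Longrightarrow> 1 + \<gamma> < \<delta>"
  shows "1 + \<beta> \<le> \<delta>"
  unfolding plus_ordinal_def ord_plus.simps[of _ \<beta>]
  by (rule Least_le) (use assms in \<open>auto simp: plus_ordinal_def\<close>)

text \<open>
  The \<open>LEAST\<close> in the definition of \<open>1 + \<beta>\<close> is attained because \<open>1 + \<beta>\<close> is at most the
  successor of \<open>\<beta>\<close>.
\<close>

lemma one_plus_ordinal:
  fixes \<beta> :: ordinal
  shows one_le_one_plus: "1 \<le> 1 + \<beta>"
    and one_plus_less: "\<gamma> < \<beta> \<Longrightarrow> 1 + \<gamma> < 1 + \<beta>"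
proof -
  have suc: "1 + \<beta> \<le> \<delta>" if "\<beta> < \<delta>" for \<beta> \<delta> :: ordinal
    using that
  proof (induction \<beta> arbitrary: \<delta> rule: less_induct)
    case (less \<beta>)
    show ?case
    proof (rule one_plus_le)
      show "1 \<le> \<delta>"
        using less.prems zero_ordinal_le[of \<beta>] by (intro one_ordinal_le) auto
      \<comment> \<open>The induction hypothesis, with \<open>\<beta>\<close> itself as the bound
        above \<open>\<gamma>\<close>, gives
        \<open>1 + \<gamma> \<le> \<beta> < \<delta>\<close>.\<close>
      show "1 + \<gamma> < \<delta>" if "\<gamma> < \<beta>" for \<gamma>
        using less.IH[OF that that] less.prems by simp
    qed
  qed
  obtain \<delta> where \<delta>: "\<beta> < \<delta>"
    using ordinal_no_top by blast
  have "1 \<le> \<delta> \<and> (\<forall>\<epsilon> \<in> ord_plus 1 ` {..<\<beta>}. \<epsilon> < \<delta>)"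
    using suc \<delta> zero_ordinal_le[of \<beta>]
    by (force simp flip: plus_ordinal_def intro: one_ordinal_le)
  from LeastI[of "\<lambda>\<delta>. 1 \<le> \<delta> \<and> (\<forall>\<epsilon> \<in> ord_plus 1 ` {..<\<beta>}. \<epsilon> < \<delta>)", OF this]
  have "1 \<le> 1 + \<beta> \<and> (\<forall>\<epsilon> \<in> ord_plus 1 ` {..<\<beta>}. \<epsilon> < 1 + \<beta>)"
    by (simp add: plus_ordinal_def ord_plus.simps[of _ \<beta>])
  then show "1 \<le> 1 + \<beta>" "\<gamma> < \<beta> \<Longrightarrow> 1 + \<gamma> < 1 + \<beta>"
    by (auto simp: plus_ordinal_def)
qed

text \<open>If \<open>1 + \<beta> < \<beta>\<close>, strict monotonicity makes
  \<open>1 + \<beta>\<close> a smaller counterexample.\<close>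

lemma le_one_plus: "(\<beta> :: ordinal) \<le> 1 + \<beta>"
proof (induction \<beta> rule: less_induct)
  case (less \<beta>)
  show ?case
    using less[of "1 + \<beta>"] one_plus_less[of "1 + \<beta>" \<beta>] by (meson leD leI)
qed

lemma inj_one_plus: "inj one_plus"
proof (rule injI)
  have Some_pos: "one_plus (Some \<beta>) \<noteq> 0" for \<beta>
    using one_le_one_plus[of \<beta>] zero_less_one_ordinal by auto
  fix d e assume *: "one_plus d = one_plus e"
  show "d = e"
  proof (cases d)
    case None
    then show ?thesis using * Some_pos by (cases e) (auto dest: sym)
  next
    case (Some \<beta>)
    with * Some_pos obtain \<gamma> where "e = Some \<gamma>" by (cases e) auto
    with * Some one_plus_less[of \<beta> \<gamma>] one_plus_less[of \<gamma> \<beta>] show ?thesis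
      by (cases \<beta> \<gamma> rule: linorder_cases) auto
  qed
qed

text \<open>Left subtraction of one: for nonzero \<open>\<tau>\<close>, the least
  \<open>\<beta>\<close> with \<open>\<tau> \<le> 1 + \<beta>\<close> attains equality, because all
  earlier values lie below \<open>\<tau>\<close>.\<close>

lemma surj_one_plus: "\<exists>d. one_plus d = \<tau>"
proof (cases "\<tau> = 0")
  case True
  then have "one_plus None = \<tau>" by simp
  then show ?thesis ..
next
  case False
  define \<beta> where "\<beta> = (LEAST \<beta>. \<tau> \<le> 1 + \<beta>)"
  have "\<tau> \<le> 1 + \<beta>"
    unfolding \<beta>_def by (rule LeastI) (rule le_one_plus)
  moreover have "1 + \<beta> \<le> \<tau>"
  proof (rule one_plus_le)
    show "1 \<le> \<tau>"
      using False zero_ordinal_le[of \<tau>] by (intro one_ordinal_le) simp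
    show "1 + \<gamma> < \<tau>" if "\<gamma> < \<beta>" for \<gamma>
      using not_less_Least[OF that[unfolded \<beta>_def]] by simp
  qed
  ultimately have "one_plus (Some \<beta>) = \<tau>" by simp
  then show ?thesis ..
qed

text \<open>Bijectivity of \<open>one_plus\<close> makes the \<open>THE\<close> in
  \<open>game_dim\<close> well defined.\<close>

lemma one_plus_game_dim: "one_plus (game_dim X) = tp_Sc X"
  unfolding game_dim_def
  by (rule theI') (metis surj_one_plus inj_one_plus injD)

lemma game_dim_le_Some:
  assumes "winning_strategy_TWO \<alpha> X \<sigma>"
  shows "game_dim X \<le> Some \<alpha>"
proof (cases "game_dim X")
  case (Some \<beta>)
  have "\<beta> \<le> 1 + \<beta>"
    by (rule le_one_plus)
  also have "1 + \<beta> = tp_Sc X"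
    using one_plus_game_dim[of X] Some by simp
  also have "tp_Sc X \<le> \<alpha>"
    unfolding tp_Sc_def using assms by (intro Least_le) blast
  finally show ?thesis
    by (simp add: Some)
qed simp


section \<open>Disjoint refinements and the winning strategy\<close>

text \<open>For the points to be covered, lying in a listed closed ball is the same as lying in its
  open ball, so the first open ball that contains such a point keeps it when the earlier closed
  balls are removed.\<close>

lemma (in Metric_space) disjoint_open_refinement:
  assumes C: "countable C" "C \<subseteq> M" "mtopology closure_of C = M"
    and D: "countable D" "\<And>a b :: real. a < b \<Longrightarrow> \<exists>r\<in>D. a < r \<and> r < b"
    and A: "open_cover mtopology A"
  obtains B where "legal_response A B" "\<And>V. V \<in> B \<Longrightarrow> openin mtopology V"
    "{x \<in> M. \<forall>c\<in>C. d c x \<notin> D} \<subseteq> \<Union>B"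
proof -
  define P where "P = {(c, r) \<in> C \<times> D. \<exists>U\<in>A. mball c r \<subseteq> U}"
  define n where "n = to_nat_on P"
  define E where "E p = {q \<in> P. n q < n p}" for p
  define V where "V p = mball (fst p) (snd p) - (\<Union>q\<in>E p. mcball (fst q) (snd q))" for p
  have "countable P"
    using C(1) D(1) by (rule countable_subset[rotated, OF countable_SIGMA]) (auto simp: P_def)
  then have n: "inj_on n P"
    unfolding n_def by (rule inj_on_to_nat_on)
  show thesis
  proof
    have disj: "disjnt (V p) (V q)" if "p \<in> P" "n p < n q" for p q
    proof -
      have "p \<in> E q"
        using that by (simp add: E_def)
      then have "V q \<inter> mcball (fst p) (snd p) = {}"
        by (auto simp: V_def)
      moreover have "V p \<subseteq> mcball (fst p) (snd p)"
        by (auto simp: V_def)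
      ultimately show ?thesis
        by (auto simp: disjnt_def)
    qed
    have "disjnt (V p) (V q)" if "p \<in> P" "q \<in> P" "p \<noteq> q" for p q
      using disj[of p q] disj[of q p] n that by (metis disjnt_sym inj_onD neqE)
    then have "pairwise disjnt (V ` P)"
      by (auto simp: pairwise_image pairwise_def)
    moreover have "\<exists>U\<in>A. V p \<subseteq> U" if p: "p \<in> P" for p
    proof -
      obtain U where "U \<in> A" "mball (fst p) (snd p) \<subseteq> U"
        using p unfolding P_def case_prod_beta by blast
      then show ?thesis
        by (intro bexI[of _ U]) (auto simp: V_def)
    qed
    ultimately show "legal_response A (V ` P)"
      by (auto simp: legal_response_def)
  next
    fix W assume "W \<in> V ` P"
    then obtain p where p: "W = V p" by blast
    \<comment> \<open>Only finitely many closed balls precede \<open>p\<close>, so removing their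
      union leaves an open set.\<close>
    have "finite (n ` E p)"
      by (rule finite_subset[of _ "{..<n p}"]) (auto simp: E_def)
    then have "finite (E p)"
      by (rule finite_imageD) (use n in \<open>auto simp: E_def intro: inj_on_subset\<close>)
    then show "openin mtopology W"
      unfolding p V_def by (intro openin_diff closedin_Union) auto
  next
    show "{x \<in> M. \<forall>c\<in>C. d c x \<notin> D} \<subseteq> \<Union>(V ` P)"
    proof safe
      fix x assume x: "x \<in> M" "\<forall>c\<in>C. d c x \<notin> D"
      obtain U where U: "U \<in> A" "x \<in> U" "openin mtopology U"
        using A x by (auto simp: open_cover_def)
      obtain e where e: "e > 0" "mball x e \<subseteq> U"
        using U by (auto simp: openin_mtopology)
      obtain c where c: "c \<in> C" "d x c < e / 3"
        using C(3) x e(1) by (force simp: metric_closure_of dest!: spec[of _ "e / 3"])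
      \<comment> \<open>The lower bound puts \<open>x\<close> into \<open>mball c r\<close>; the
        upper bound keeps this ball inside \<open>mball x e\<close>, since
        \<open>e / 3 + e / 2 < e\<close>.\<close>
      obtain r where r: "r \<in> D" "e / 3 < r" "r < e / 2"
        using D(2)[of "e / 3" "e / 2"] e by auto
      have "mball c r \<subseteq> mball x e"
        using x c C(2) r by (smt (verit) in_mball subsetI triangle field_sum_of_halves)
      then have "(c, r) \<in> P"
        using c r U e by (auto simp: P_def)
      moreover have "x \<in> mball c r"
        using x c r C(2) commute[of x c] by auto
      ultimately have "\<exists>p. p \<in> P \<and> x \<in> mball (fst p) (snd p)" by force
      then obtain p where p: "p \<in> P" "x \<in> mball (fst p) (snd p)"
        and min: "\<And>q. q \<in> P \<and> x \<in> mball (fst q) (snd q) \<Longrightarrow> n p \<le> n q"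
        using ex_has_least_nat[of "\<lambda>p. p \<in> P \<and> x \<in> mball (fst p) (snd p)" _ n] by blast
      have "x \<notin> mcball (fst q) (snd q)" if q: "q \<in> E p" for q
      proof
        assume "x \<in> mcball (fst q) (snd q)"
        \<comment> \<open>This excludes the boundary sphere, so \<open>x\<close> would lie in an
          open ball listed before \<open>p\<close>, against the choice of \<open>p\<close>.\<close>
        moreover have "d (fst q) x \<noteq> snd q"
          using q x by (auto simp: E_def P_def)
        ultimately have "x \<in> mball (fst q) (snd q)" by auto
        with min[of q] q show False by (auto simp: E_def)
      qed
      with p show "x \<in> \<Union>(V ` P)"
        by (auto simp: V_def)
    qed
  qed
qed

lemma (in Metric_space) winning_strategy_TWO_omega1:
  assumes "separable_space mtopology"
  obtains \<sigma> where "winning_strategy_TWO omega1 mtopology \<sigma>"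
proof -
  obtain C where C: "countable C" "C \<subseteq> M" "mtopology closure_of C = M"
    using assms by (auto simp: separable_space_def)
  obtain g :: "ordinal \<Rightarrow> real" where g: "inj_on g {..<omega1}"
    using inj_on_real_if_countable_lessThan[of "{..<omega1}"] countable_lessThan_if_less_omega1
    by auto
  define D where "D \<gamma> = (+) (g \<gamma>) ` \<rat>" for \<gamma>
  define Z where "Z \<gamma> = {x \<in> M. \<forall>c\<in>C. d c x \<notin> D \<gamma>}" for \<gamma>
  have D: "countable (D \<gamma>)" "\<And>a b. a < b \<Longrightarrow> \<exists>r\<in>D \<gamma>. a < r \<and> r < b" for \<gamma>
  proof -
    show "countable (D \<gamma>)"
      by (simp add: D_def countable_rat)
    fix a b :: real assume "a < b"
    then obtain q where "q \<in> \<rat>" "a - g \<gamma> < q" "q < b - g \<gamma>"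
      using Rats_dense_in_real[of "a - g \<gamma>" "b - g \<gamma>"] by auto
    then show "\<exists>r\<in>D \<gamma>. a < r \<and> r < b"
      by (intro bexI[of _ "g \<gamma> + q"]) (auto simp: D_def)
  qed
  define Q where "Q \<gamma> A B \<longleftrightarrow>
    legal_response A B \<and> (\<forall>V\<in>B. openin mtopology V) \<and> Z \<gamma> \<subseteq> \<Union>B" for \<gamma> A B
  \<comment> \<open>Only the current cover is consulted; restricting ONE's moves to
    \<open>{..\<gamma>}\<close> retains it.\<close>
  define \<sigma> where "\<sigma> \<gamma> A = (SOME B. Q \<gamma> (A \<gamma>) B)" for \<gamma> and A :: "ordinal \<Rightarrow> 'a set set"
  have Q: "Q \<gamma> (A \<gamma>) (response \<sigma> A \<gamma>)" if "open_cover mtopology (A \<gamma>)" for \<gamma> A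
  proof -
    have "\<exists>B. Q \<gamma> (A \<gamma>) B"
      by (rule disjoint_open_refinement[OF C D that]) (auto simp: Q_def Z_def)
    then show ?thesis
      by (simp add: response_def \<sigma>_def someI_ex)
  qed
  have Z: "\<exists>\<gamma><omega1. x \<in> Z \<gamma>" if x: "x \<in> M" for x
  proof (rule ccontr)
    assume "\<not> ?thesis"
    \<comment> \<open>A point outside every \<open>Z \<gamma>\<close> has, for each
      \<open>\<gamma>\<close>, a distance \<open>d c x = g \<gamma> + q\<close> with rational
      \<open>q\<close>. This leaves only countably many values for
      \<open>g \<gamma>\<close>.\<close>
    then have "g ` {..<omega1} \<subseteq> (\<lambda>(c, q). d c x - q) ` (C \<times> \<rat>)"
      using x by (force simp: Z_def D_def)
    then have "countable (g ` {..<omega1})"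
      by (rule countable_subset) (use C(1) in \<open>auto intro: countable_rat\<close>)
    with g uncountable_lessThan_omega1 show False
      by (auto dest: countable_image_inj_on)
  qed
  have "winning_strategy_TWO omega1 mtopology \<sigma>"
    unfolding winning_strategy_TWO_def
  proof (intro allI impI conjI)
    fix A :: "ordinal \<Rightarrow> 'a set set" and \<gamma>
    assume A: "\<forall>\<gamma><omega1. open_cover mtopology (A \<gamma>)"
    show "legal_response (A \<gamma>) (response \<sigma> A \<gamma>)" if "\<gamma> < omega1"
      using Q[of A \<gamma>] A that by (auto simp: Q_def)
    have op: "openin mtopology V" if "\<gamma> < omega1" "V \<in> response \<sigma> A \<gamma>" for \<gamma> V
      using Q[of A \<gamma>] A that by (auto simp: Q_def)
    moreover have "x \<in> \<Union>(\<Union>\<gamma>\<in>{..<omega1}. response \<sigma> A \<gamma>)" if x: "x \<in> M" for x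
    proof -
      obtain \<gamma> where "\<gamma> < omega1" "x \<in> Z \<gamma>"
        using Z[OF x] by blast
      then show ?thesis
        using Q[of A \<gamma>] A by (fastforce simp: Q_def)
    qed
    moreover have "V \<subseteq> M" if "\<gamma> < omega1" "V \<in> response \<sigma> A \<gamma>" for \<gamma> V
      using openin_subset[OF op[OF that]] by simp
    ultimately show "open_cover mtopology (\<Union>\<gamma>\<in>{..<omega1}. response \<sigma> A \<gamma>)"
      unfolding open_cover_def topspace_mtopology by blast
  qed
  then show thesis by (rule that)
qed

theorem theorem21:
  fixes M :: "'a set" and d :: "'a \<Rightarrow> 'a \<Rightarrow> real"
  assumes "Metric_space M d"
    and "separable_space (Metric_space.mtopology M d)"
  shows "game_dim (Metric_space.mtopology M d) \<le> Some omega1"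
  using Metric_space.winning_strategy_TWO_omega1[OF assms] game_dim_le_Some by metis

end
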